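(* Let $G=(V,E)$ be a finite undirected graph with $V=\{v_1,\dots,v_n\}$, let $\mathcal A_G$ be the set of maximal acyclic subgraphs of $G$, and let $\triangle^{|\mathcal A_G|-1}$ be the set of probability distributions $\bm\pi$ on $\mathcal A_G$. Let $\mathcal L(\bm\pi,\bm\lambda,\bm\theta)$ be the (regularized) ACVAE objective defined in the context, where $\bm\lambda$ ranges over the variational parameters and $\bm\theta$ over the model parameters. Consider either of the two optimization problems $$\text{(empirical Bayes)}\quad \max_{\bm\lambda,\bm\theta}\ \max_{\bm\pi\in\triangle^{|\mathcal A_G|-1}}\ \mathcal L(\bm\pi,\bm\lambda,\bm\theta),\qquad\qquad \text{(saddle-point)}\quad \max_{\bm\lambda,\bm\theta}\ \min_{\bm\pi\in\triangle^{|\mathcal A_G|-1}}\ \mathcal L(\bm\pi,\bm\lambda,\bm\theta).$$ If the problem under consideration has a global optimum, then at least one of its global optima $(\bm\pi^*,\bm\lambda^*,\bm\theta^* )$ has the property that $\bm\pi^*$ places all of its probability mass on a single maximal acyclic subgraph, i.e. there is $G'^*\in\mathcal A_G$ with $\bm\pi^*(G'^* )=1$.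
   Context: **Maximal acyclic subgraphs.** For an undirected graph $G=(V,E)$, an acyclic subgraph $G'=(V',E')$ is a maximal acyclic subgraph of $G$ if $V'=V$ and adding any edge of $E\setminus E'$ to $E'$ creates a cycle in $G'$. $\mathcal A_G$ is the set of all maximal acyclic subgraphs of $G$. For $\bm\pi\in\triangle^{|\mathcal A_G|-1}$, $\bm\pi(G')$ denotes the probability of $G'\in\mathcal A_G$. For $e\in E$, the edge weight is $$w^{\mathrm{MAS}}_{G,\bm\pi,e}:=\sum_{G'=(V,E')\in\mathcal A_G,\ e\in E'}\bm\pi(G').$$ **Model.** There are data points $\bm x_1,\dots,\bm x_n\in\mathbb R^D$ ($\bm x_i$ attached to vertex $v_i$) and latent variables $\bm z_1,\dots,\bm z_n\in\mathbb R^d$. The following are given: - fixed (parameter-free) prior densities: a singleton density $p_0(\bm z_i)$ on $\mathbb R^d$ and a pairwise density $p_0(\bm z_i,\bm z_j)$ on $\mathbb R^d\times\mathbb R^d$ with singleton marginals $p_0$; - conditional model densities $p_{\bm\theta}(\bm x_i\mid\bm z_i)$, indexed by the model parameter $\bm\theta$; - variational densities $q_{\bm\lambda}(\bm z_i\mid\bm x_i)$ and $q_{\bm\lambda}(\bm z_i,\bm z_j\mid\bm x_i,\bm x_j)$, indexed by the variational parameter $\bm\lambda$, satisfying the symmetry $q_{\bm\lambda}(\bm z_i,\bm z_j\mid\bm x_i,\bm x_j)=q_{\bm\lambda}(\bm z_j,\bm z_i\mid\bm x_j,\bm x_i)$ and the consistency $\int q_{\bm\lambda}(\bm z_i,\bm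 z_j\mid\bm x_i,\bm x_j)\,d\bm z_j=q_{\bm\lambda}(\bm z_i\mid\bm x_i)$. The parameters $\bm\lambda$ and $\bm\theta$ range over given parameter sets. All expectations and Kullback–Leibler divergences $\mathrm{KL}(\cdot\|\cdot)$ appearing below are assumed finite, so the objective is real-valued. **Objective.** With $$\begin{aligned}\mathcal L_0(\bm\pi,\bm\lambda,\bm\theta):={}&\sum_{i=1}^n\Big(\mathbb E_{q_{\bm\lambda}(\bm z_i|\bm x_i)}[\log p_{\bm\theta}(\bm x_i|\bm z_i)]-\mathrm{KL}(q_{\bm\lambda}(\bm z_i|\bm x_i)\|p_0(\bm z_i))\Big)\\&-\sum_{(v_i,v_j)\in E}w^{\mathrm{MAS}}_{G,\bm\pi,(v_i,v_j)}\Big(\mathrm{KL}(q_{\bm\lambda}(\bm z_i,\bm z_j|\bm x_i,\bm x_j)\|p_0(\bm z_i,\bm z_j))\\&\qquad-\mathrm{KL}(q_{\bm\lambda}(\bm z_i|\bm x_i)\|p_0(\bm z_i))-\mathrm{KL}(q_{\bm\lambda}(\bm z_j|\bm x_j)\|p_0(\bm z_j))\Big)\end{aligned}$$ and a fixed regularization strength $\gamma>0$, the ACVAE objective is $$\begin{aligned}\mathcal L(\bm\pi,\bm\lambda,\bm\theta):={}&\mathcal L_0(\bm\pi,\bm\lambda,\bm\theta)-\gamma\Big(\sum_{i=1}^n\mathrm{KL}(q_{\bm\lambda}(\bm z_i|\bm x_i)\|p_0(\bm z_i))\\&+\frac2n\sum_{1\le i<j\le n}\mathbb E_{q_{\bm\lambda}(\bm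 z_i,\bm z_j|\bm x_i,\bm x_j)}\log\frac{q_{\bm\lambda}(\bm z_i,\bm z_j|\bm x_i,\bm x_j)}{q_{\bm\lambda}(\bm z_i|\bm x_i)\,q_{\bm\lambda}(\bm z_j|\bm x_j)}\Big).\end{aligned}$$ **Global optima.** A global optimum of the empirical Bayes problem is a triple $(\bm\pi^*,\bm\lambda^*,\bm\theta^* )$ maximizing $\mathcal L$ jointly. A global optimum of the saddle-point (max–min) problem is a triple $(\bm\pi^*,\bm\lambda^*,\bm\theta^* )$ such that $(\bm\lambda^*,\bm\theta^* )$ maximizes $(\bm\lambda,\bm\theta)\mapsto\min_{\bm\pi}\mathcal L(\bm\pi,\bm\lambda,\bm\theta)$ and $\bm\pi^*$ minimizes $\bm\pi\mapsto\mathcal L(\bm\pi,\bm\lambda^*,\bm\theta^* )$. *)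

theory Defs
  imports "HOL-Probability.Probability"
begin

section \<open>Finite simple graphs and maximal acyclic subgraphs\<close>

type_synonym ugraph = "nat set \<times> nat set set"

definition wf_ugraph :: "ugraph \<Rightarrow> bool" where
  "wf_ugraph = (\<lambda>(V, E). finite V \<and> E \<subseteq> {{u, v} | u v. u \<in> V \<and> v \<in> V \<and> u \<noteq> v})"

definition subgraph :: "ugraph \<Rightarrow> ugraph \<Rightarrow> bool" where
  "subgraph H G \<longleftrightarrow> wf_ugraph H \<and> fst H \<subseteq> fst G \<and> snd H \<subseteq> snd G"

text \<open>A cycle is given by its distinct vertices in cyclic order; at least three of them are
  required, so that traversing one edge back and forth does not count.\<close>

definition is_cycle :: "ugraph \<Rightarrow> nat list \<Rightarrow> bool" where
  "is_cycle G vs \<longleftrightarrow> 3 \<le> length vs \<and> distinct vs \<and> set vs \<subseteq> fst G \<and>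
     (\<forall>k < length vs. {vs ! k, vs ! (Suc k mod length vs)} \<in> snd G)"

definition acyclic_ugraph :: "ugraph \<Rightarrow> bool" where
  "acyclic_ugraph G \<longleftrightarrow> (\<nexists>vs. is_cycle G vs)"

definition MAS :: "ugraph \<Rightarrow> ugraph set" where
  "MAS G = {H. subgraph H G \<and> acyclic_ugraph H \<and> fst H = fst G \<and>
     (\<forall>e \<in> snd G - snd H. \<not> acyclic_ugraph (fst H, insert e (snd H)))}"

definition MAS_simplex :: "ugraph \<Rightarrow> ugraph pmf set" where
  "MAS_simplex G = {\<pi>. set_pmf \<pi> \<subseteq> MAS G}"

definition wMAS :: "ugraph \<Rightarrow> ugraph pmf \<Rightarrow> nat set \<Rightarrow> real" where
  "wMAS G \<pi> e = (\<Sum>H \<in> {H \<in> MAS G. e \<in> snd H}. pmf \<pi> H)"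


section \<open>Densities and Kullback-Leibler divergence\<close>

definition dens :: "('a::euclidean_space \<Rightarrow> real) \<Rightarrow> 'a measure" where
  "dens f = density lborel (\<lambda>z. ennreal (f z))"

definition prob_density :: "('a::euclidean_space \<Rightarrow> real) \<Rightarrow> bool" where
  "prob_density f \<longleftrightarrow> f \<in> borel_measurable borel \<and> (\<forall>z. 0 \<le> f z) \<and> prob_space (dens f)"

text \<open>\<open>KL_divergence b M N\<close> is the divergence of \<open>N\<close> from \<open>M\<close>, hence the swapped arguments:
  \<open>KL q p\<close> is $\mathrm{KL}(q \| p)$, with natural logarithm.\<close>

definition KL :: "('a::euclidean_space \<Rightarrow> real) \<Rightarrow> ('a \<Rightarrow> real) \<Rightarrow> real" where
  "KL q p = KL_divergence (exp 1) (dens p) (dens q)"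

text \<open>\<open>KL_divergence\<close> is a Bochner integral and thus real-valued in all cases. The negative part of
  the integrand is always integrable for probability measures, so the divergence in the extended
  sense is finite exactly under the following condition.\<close>

definition KL_finite :: "('a::euclidean_space \<Rightarrow> real) \<Rightarrow> ('a \<Rightarrow> real) \<Rightarrow> bool" where
  "KL_finite q p \<longleftrightarrow> absolutely_continuous (dens p) (dens q) \<and>
     integrable (dens q) (entropy_density (exp 1) (dens p) (dens q))"


section \<open>The model\<close>

text \<open>Vertex $v_i$ is the number $i \in \{1,\dots,n\}$. \<open>lik M \<theta> x z\<close> is $p_\theta(x \mid z)$,
  \<open>post M l x z\<close> is $q_\lambda(z \mid x)$, and \<open>post2 M l x x' (z, z')\<close> is
  $q_\lambda(z, z' \mid x, x')$.\<close>

record ('d::finite, 'm::finite, 'l, 't) acvae =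
  obs :: "nat \<Rightarrow> real^'m"
  prior :: "real^'d \<Rightarrow> real"
  prior2 :: "(real^'d) \<times> (real^'d) \<Rightarrow> real"
  lik :: "'t \<Rightarrow> real^'m \<Rightarrow> real^'d \<Rightarrow> real"
  post :: "'l \<Rightarrow> real^'m \<Rightarrow> real^'d \<Rightarrow> real"
  post2 :: "'l \<Rightarrow> real^'m \<Rightarrow> real^'m \<Rightarrow> (real^'d) \<times> (real^'d) \<Rightarrow> real"
  Lam :: "'l set"
  Theta :: "'t set"

text \<open>Equalities between densities are required almost everywhere only. The variational densities
  are only constrained at the data points, the pairwise ones at pairs of distinct indices.\<close>

definition valid_prior :: "('d::finite, 'm::finite, 'l, 't) acvae \<Rightarrow> bool" where
  "valid_prior M \<longleftrightarrow>
     prob_density (prior M) \<and> prob_density (prior2 M) \<and>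
     (AE z in lborel. (\<integral>\<^sup>+ z'. ennreal (prior2 M (z, z')) \<partial>lborel) = ennreal (prior M z)) \<and>
     (AE z' in lborel. (\<integral>\<^sup>+ z. ennreal (prior2 M (z, z')) \<partial>lborel) = ennreal (prior M z'))"

definition valid_lik :: "('d::finite, 'm::finite, 'l, 't) acvae \<Rightarrow> bool" where
  "valid_lik M \<longleftrightarrow> (\<forall>\<theta> \<in> Theta M. \<forall>z. prob_density (\<lambda>x. lik M \<theta> x z))"

definition valid_post :: "nat \<Rightarrow> ('d::finite, 'm::finite, 'l, 't) acvae \<Rightarrow> bool" where
  "valid_post n M \<longleftrightarrow> (\<forall>l \<in> Lam M.
     (\<forall>i \<in> {1..n}. prob_density (post M l (obs M i))) \<and>
     (\<forall>i \<in> {1..n}. \<forall>j \<in> {1..n}. i \<noteq> j \<longrightarrow>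
        prob_density (post2 M l (obs M i) (obs M j)) \<and>
        (AE (z, z') in lborel.
           post2 M l (obs M i) (obs M j) (z, z') = post2 M l (obs M j) (obs M i) (z', z)) \<and>
        (AE z in lborel.
           (\<integral>\<^sup>+ z'. ennreal (post2 M l (obs M i) (obs M j) (z, z')) \<partial>lborel) =
             ennreal (post M l (obs M i) z))))"

definition index_pairs :: "nat \<Rightarrow> (nat \<times> nat) set" where
  "index_pairs n = {(i, j). 1 \<le> i \<and> i < j \<and> j \<le> n}"

text \<open>Every undirected edge is represented once, oriented from the smaller to the larger index.\<close>

definition edge_pairs :: "nat \<Rightarrow> nat set set \<Rightarrow> (nat \<times> nat) set" where
  "edge_pairs n E = {(i, j) \<in> index_pairs n. {i, j} \<in> E}"

definition log_lik :: "('d::finite, 'm::finite, 'l, 't) acvae \<Rightarrow> 'l \<Rightarrow> 't \<Rightarrow> nat \<Rightarrow> real" where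
  "log_lik M l \<theta> i = (\<integral>z. ln (lik M \<theta> (obs M i) z) \<partial>dens (post M l (obs M i)))"

definition KL1 :: "('d::finite, 'm::finite, 'l, 't) acvae \<Rightarrow> 'l \<Rightarrow> nat \<Rightarrow> real" where
  "KL1 M l i = KL (post M l (obs M i)) (prior M)"

definition KL2 :: "('d::finite, 'm::finite, 'l, 't) acvae \<Rightarrow> 'l \<Rightarrow> nat \<Rightarrow> nat \<Rightarrow> real" where
  "KL2 M l i j = KL (post2 M l (obs M i) (obs M j)) (prior2 M)"

definition log_ratio ::
    "('d::finite, 'm::finite, 'l, 't) acvae \<Rightarrow> 'l \<Rightarrow> nat \<Rightarrow> nat \<Rightarrow> (real^'d) \<times> (real^'d) \<Rightarrow> real" where
  "log_ratio M l i j = (\<lambda>(z, z'). ln (post2 M l (obs M i) (obs M j) (z, z') /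
     (post M l (obs M i) z * post M l (obs M j) z')))"

definition mut_inf :: "('d::finite, 'm::finite, 'l, 't) acvae \<Rightarrow> 'l \<Rightarrow> nat \<Rightarrow> nat \<Rightarrow> real" where
  "mut_inf M l i j = (\<integral>u. log_ratio M l i j u \<partial>dens (post2 M l (obs M i) (obs M j)))"

text \<open>Since \<open>ln 0 = 0\<close>, integrability of the log-likelihood does not by itself exclude
  $\log 0 = -\infty$ on a set of positive probability. The log-ratio needs no such condition:
  its argument is positive almost surely by consistency of the marginals.\<close>

definition finite_terms ::
    "nat \<Rightarrow> nat set set \<Rightarrow> ('d::finite, 'm::finite, 'l, 't) acvae \<Rightarrow> bool" where
  "finite_terms n E M \<longleftrightarrow> (\<forall>l \<in> Lam M.
     (\<forall>i \<in> {1..n}. KL_finite (post M l (obs M i)) (prior M)) \<and>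
     (\<forall>(i, j) \<in> edge_pairs n E. KL_finite (post2 M l (obs M i) (obs M j)) (prior2 M)) \<and>
     (\<forall>(i, j) \<in> index_pairs n.
        integrable (dens (post2 M l (obs M i) (obs M j))) (log_ratio M l i j)) \<and>
     (\<forall>\<theta> \<in> Theta M. \<forall>i \<in> {1..n}.
        (AE z in dens (post M l (obs M i)). 0 < lik M \<theta> (obs M i) z) \<and>
        integrable (dens (post M l (obs M i))) (\<lambda>z. ln (lik M \<theta> (obs M i) z))))"


section \<open>The objective and its optima\<close>

definition L0 :: "nat \<Rightarrow> nat set set \<Rightarrow> ('d::finite, 'm::finite, 'l, 't) acvae \<Rightarrow>
    ugraph pmf \<Rightarrow> 'l \<Rightarrow> 't \<Rightarrow> real" where
  "L0 n E M \<pi> l \<theta> =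
     (\<Sum>i = 1..n. log_lik M l \<theta> i - KL1 M l i)
     - (\<Sum>(i, j) \<in> edge_pairs n E.
          wMAS ({1..n}, E) \<pi> {i, j} * (KL2 M l i j - KL1 M l i - KL1 M l j))"

definition ACVAE_objective :: "nat \<Rightarrow> nat set set \<Rightarrow> ('d::finite, 'm::finite, 'l, 't) acvae \<Rightarrow>
    real \<Rightarrow> ugraph pmf \<Rightarrow> 'l \<Rightarrow> 't \<Rightarrow> real" where
  "ACVAE_objective n E M \<gamma> \<pi> l \<theta> =
     L0 n E M \<pi> l \<theta>
     - \<gamma> * ((\<Sum>i = 1..n. KL1 M l i)
            + 2 / real n * (\<Sum>(i, j) \<in> index_pairs n. mut_inf M l i j))"

definition EB_optimum :: "nat \<Rightarrow> nat set set \<Rightarrow> ('d::finite, 'm::finite, 'l, 't) acvae \<Rightarrow>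
    real \<Rightarrow> ugraph pmf \<times> 'l \<times> 't \<Rightarrow> bool" where
  "EB_optimum n E M \<gamma> =
     is_arg_max (\<lambda>(\<pi>, l, \<theta>). ACVAE_objective n E M \<gamma> \<pi> l \<theta>)
       (\<lambda>(\<pi>, l, \<theta>). \<pi> \<in> MAS_simplex ({1..n}, E) \<and> l \<in> Lam M \<and> \<theta> \<in> Theta M)"

text \<open>The infimum is a genuine minimum: the objective is affine in the finitely many values
  \<open>pmf \<pi> H\<close>, \<open>H \<in> MAS G\<close>, and the simplex is nonempty and compact.\<close>

definition saddle_optimum :: "nat \<Rightarrow> nat set set \<Rightarrow> ('d::finite, 'm::finite, 'l, 't) acvae \<Rightarrow>
    real \<Rightarrow> ugraph pmf \<times> 'l \<times> 't \<Rightarrow> bool" where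
  "saddle_optimum n E M \<gamma> = (\<lambda>(\<pi>s, ls, \<theta>s).
     is_arg_max (\<lambda>(l, \<theta>). INF \<pi> \<in> MAS_simplex ({1..n}, E). ACVAE_objective n E M \<gamma> \<pi> l \<theta>)
       (\<lambda>(l, \<theta>). l \<in> Lam M \<and> \<theta> \<in> Theta M) (ls, \<theta>s) \<and>
     is_arg_min (\<lambda>\<pi>. ACVAE_objective n E M \<gamma> \<pi> ls \<theta>s)
       (\<lambda>\<pi>. \<pi> \<in> MAS_simplex ({1..n}, E)) \<pi>s)"

end

(* For fixed lambda and theta the objective is affine in the edge weights, which are linear in pi.
   Hence its value at pi is the pi-average of its values at the point masses, so some point mass in
   the simplex does at least as well as pi, for maximization and for minimization alike. *)
theory Submission
  imports Defs
begin

text \<open>A maximal acyclic subgraph keeps all vertices, so it is determined by a subset of the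
  finite edge set. Sums over \<open>MAS\<close> rely on this, since a sum over an infinite set is 0
  by convention.\<close>

lemma finite_MAS:
  assumes "wf_ugraph (V, E)"
  shows "finite (MAS (V, E))"
proof -
  have "finite V" and "E \<subseteq> Pow V"
    using assms by (auto simp: wf_ugraph_def)
  then have "finite E"
    by (meson finite_Pow_iff finite_subset)
  moreover have "MAS (V, E) \<subseteq> {V} \<times> Pow E"
    by (auto simp: MAS_def subgraph_def)
  ultimately show ?thesis
    by (auto intro: finite_subset)
qed

lemma wMAS_return_pmf:
  assumes "finite (MAS G)" and "H \<in> MAS G"
  shows "wMAS G (return_pmf H) e = of_bool (e \<in> snd H)"
  using assms by (auto simp: wMAS_def indicator_def of_bool_def pmf_return)

text \<open>At a point mass the weight of an edge is its 0/1 membership indicator, so the defining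
  sum, extended by zeros to all of \<open>MAS\<close>, is already the average of these
  indicators.\<close>

lemma wMAS_mixture:
  assumes "finite (MAS G)"
  shows "wMAS G \<pi> e = (\<Sum>H\<in>MAS G. pmf \<pi> H * wMAS G (return_pmf H) e)"
proof -
  have "wMAS G \<pi> e = (\<Sum>H\<in>MAS G. pmf \<pi> H * of_bool (e \<in> snd H))"
    unfolding wMAS_def using assms by (intro sum.mono_neutral_cong_left) auto
  then show ?thesis
    using assms by (simp add: wMAS_return_pmf)
qed

text \<open>The edge terms average because the weights are linear in \<pi>. The remaining terms
  survive averaging because the masses sum to 1, which is where membership in
  \<open>MAS_simplex\<close> enters.\<close>

lemma ACVAE_objective_mixture:
  assumes "finite (MAS ({1..n}, E))" and "\<pi> \<in> MAS_simplex ({1..n}, E)"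
  shows "ACVAE_objective n E M \<gamma> \<pi> l \<theta> =
    (\<Sum>H\<in>MAS ({1..n}, E). pmf \<pi> H * ACVAE_objective n E M \<gamma> (return_pmf H) l \<theta>)"
proof -
  let ?G = "({1..n}, E)"
  \<comment> \<open>\<open>C\<close> gathers everything free of the distribution on subgraphs,
    including the whole regularizer; \<open>K\<close> gives the coefficients of the edge weights, up
    to sign.\<close>
  define C where "C = (\<Sum>i = 1..n. log_lik M l \<theta> i - KL1 M l i) -
    \<gamma> * ((\<Sum>i = 1..n. KL1 M l i) + 2 / real n * (\<Sum>(i, j)\<in>index_pairs n. mut_inf M l i j))"
  define K where "K = (\<lambda>(i, j). KL2 M l i j - KL1 M l i - KL1 M l j)"
  have objective: "ACVAE_objective n E M \<gamma> \<rho> l \<theta> =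
      C - (\<Sum>p\<in>edge_pairs n E. wMAS ?G \<rho> {fst p, snd p} * K p)" for \<rho>
    by (simp add: ACVAE_objective_def L0_def C_def K_def case_prod_beta)
  have total: "(\<Sum>H\<in>MAS ?G. pmf \<pi> H) = 1"
    using assms by (intro sum_pmf_eq_1) (auto simp: MAS_simplex_def)
  have "(\<Sum>p\<in>edge_pairs n E. wMAS ?G \<pi> {fst p, snd p} * K p) =
      (\<Sum>p\<in>edge_pairs n E. \<Sum>H\<in>MAS ?G.
        pmf \<pi> H * (wMAS ?G (return_pmf H) {fst p, snd p} * K p))"
    by (subst wMAS_mixture[OF assms(1)]) (simp add: sum_distrib_right mult.assoc)
  also have "\<dots> = (\<Sum>H\<in>MAS ?G. pmf \<pi> H *
      (\<Sum>p\<in>edge_pairs n E. wMAS ?G (return_pmf H) {fst p, snd p} * K p))"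
    by (subst sum.swap) (simp add: sum_distrib_left)
  finally show ?thesis
    using total by (simp add: objective right_diff_distrib sum_subtractf flip: sum_distrib_right)
qed

text \<open>A weighted average never exceeds the maximum, so a maximizer of \<open>f\<close> on
  \<open>A\<close> serves as witness.\<close>

lemma pmf_average_le_some:
  fixes f :: "'a \<Rightarrow> real"
  assumes "finite A" and "set_pmf \<pi> \<subseteq> A"
  obtains x where "x \<in> A" and "(\<Sum>y\<in>A. pmf \<pi> y * f y) \<le> f x"
proof -
  \<comment> \<open>The maximum exists because \<open>A\<close> contains the support of a
    probability mass function, which is never empty.\<close>
  have "A \<noteq> {}"
    using assms(2) set_pmf_not_empty[of \<pi>] by auto
  then obtain x where x: "x \<in> A" "\<And>y. y \<in> A \<Longrightarrow> f y \<le> f x"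
    using assms(1) by (metis Max_ge finite_imageI imageI obtains_MAX)
  have "(\<Sum>y\<in>A. pmf \<pi> y * f y) \<le> (\<Sum>y\<in>A. pmf \<pi> y * f x)"
    using x(2) by (intro sum_mono mult_left_mono) auto
  also have "\<dots> = f x"
    using sum_pmf_eq_1[OF assms] by (simp flip: sum_distrib_right)
  finally show ?thesis
    using x(1) that by blast
qed

lemma point_mass_ge:
  assumes "wf_ugraph ({1..n}, E)" and "\<pi> \<in> MAS_simplex ({1..n}, E)"
  obtains H where "H \<in> MAS ({1..n}, E)"
    and "ACVAE_objective n E M \<gamma> \<pi> l \<theta> \<le> ACVAE_objective n E M \<gamma> (return_pmf H) l \<theta>"
  using pmf_average_le_some[of "MAS ({1..n}, E)" \<pi>
      "\<lambda>H. ACVAE_objective n E M \<gamma> (return_pmf H) l \<theta>"]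
    ACVAE_objective_mixture[OF finite_MAS[OF assms(1)] assms(2), of M \<gamma> l \<theta>]
    finite_MAS[OF assms(1)] assms(2)
  by (auto simp: MAS_simplex_def)

text \<open>The averaging bound applied to the negated objective turns the maximum into a
  minimum.\<close>

lemma point_mass_le:
  assumes "wf_ugraph ({1..n}, E)" and "\<pi> \<in> MAS_simplex ({1..n}, E)"
  obtains H where "H \<in> MAS ({1..n}, E)"
    and "ACVAE_objective n E M \<gamma> (return_pmf H) l \<theta> \<le> ACVAE_objective n E M \<gamma> \<pi> l \<theta>"
  using pmf_average_le_some[of "MAS ({1..n}, E)" \<pi>
      "\<lambda>H. - ACVAE_objective n E M \<gamma> (return_pmf H) l \<theta>"]
    ACVAE_objective_mixture[OF finite_MAS[OF assms(1)] assms(2), of M \<gamma> l \<theta>]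
    finite_MAS[OF assms(1)] assms(2)
  by (auto simp: MAS_simplex_def sum_negf)

lemma return_pmf_in_MAS_simplex: "H \<in> MAS G \<Longrightarrow> return_pmf H \<in> MAS_simplex G"
  by (simp add: MAS_simplex_def)

theorem proposition1:
  fixes n :: nat and E :: "nat set set" and \<gamma> :: real
    and M :: "('d::finite, 'm::finite, 'l, 't) acvae"
  assumes "wf_ugraph ({1..n}, E)"
    and "valid_prior M" and "valid_lik M" and "valid_post n M"
    and "finite_terms n E M"
    and "\<gamma> > 0"
  shows "((\<exists>\<pi> l \<theta>. EB_optimum n E M \<gamma> (\<pi>, l, \<theta>)) \<longrightarrow>
           (\<exists>\<pi> l \<theta>. EB_optimum n E M \<gamma> (\<pi>, l, \<theta>) \<and> (\<exists>H \<in> MAS ({1..n}, E). pmf \<pi> H = 1)))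
       \<and> ((\<exists>\<pi> l \<theta>. saddle_optimum n E M \<gamma> (\<pi>, l, \<theta>)) \<longrightarrow>
           (\<exists>\<pi> l \<theta>. saddle_optimum n E M \<gamma> (\<pi>, l, \<theta>) \<and> (\<exists>H \<in> MAS ({1..n}, E). pmf \<pi> H = 1)))"
proof (intro conjI impI; elim exE)
  fix \<pi> l \<theta>
  assume opt: "EB_optimum n E M \<gamma> (\<pi>, l, \<theta>)"
  then have "\<pi> \<in> MAS_simplex ({1..n}, E)"
    by (simp add: EB_optimum_def is_arg_max_def)
  then obtain H where H: "H \<in> MAS ({1..n}, E)"
    "ACVAE_objective n E M \<gamma> \<pi> l \<theta> \<le> ACVAE_objective n E M \<gamma> (return_pmf H) l \<theta>"
    using point_mass_ge[OF assms(1)] by metis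
  \<comment> \<open>Only \<pi> is exchanged: the new triple is feasible and its value is at least
    the joint maximum.\<close>
  have "EB_optimum n E M \<gamma> (return_pmf H, l, \<theta>)"
    using opt H return_pmf_in_MAS_simplex[OF H(1)]
    by (auto simp: EB_optimum_def is_arg_max_linorder intro: order_trans)
  then show "\<exists>\<pi> l \<theta>. EB_optimum n E M \<gamma> (\<pi>, l, \<theta>) \<and> (\<exists>H \<in> MAS ({1..n}, E). pmf \<pi> H = 1)"
    using H(1) by (intro exI[of _ "return_pmf H"] exI conjI bexI[of _ H]) auto
next
  fix \<pi> l \<theta>
  assume opt: "saddle_optimum n E M \<gamma> (\<pi>, l, \<theta>)"
  then have "\<pi> \<in> MAS_simplex ({1..n}, E)"
    by (simp add: saddle_optimum_def is_arg_min_def)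
  then obtain H where H: "H \<in> MAS ({1..n}, E)"
    "ACVAE_objective n E M \<gamma> (return_pmf H) l \<theta> \<le> ACVAE_objective n E M \<gamma> \<pi> l \<theta>"
    using point_mass_le[OF assms(1)] by metis
  \<comment> \<open>The outer condition concerns only \<open>l\<close> and \<theta>, with \<pi>
    bound by the infimum, so it carries over unchanged. Only the inner minimality has to be
    transferred to the point mass.\<close>
  have "saddle_optimum n E M \<gamma> (return_pmf H, l, \<theta>)"
    using opt H return_pmf_in_MAS_simplex[OF H(1)]
    by (auto simp: saddle_optimum_def is_arg_min_linorder intro: order_trans)
  then show "\<exists>\<pi> l \<theta>. saddle_optimum n E M \<gamma> (\<pi>, l, \<theta>) \<and> (\<exists>H \<in> MAS ({1..n}, E). pmf \<pi> H = 1)"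
    using H(1) by (intro exI[of _ "return_pmf H"] exI conjI bexI[of _ H]) auto
qed

end
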